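(* The real number $\log\Gamma(x) + \log\Gamma(1-x)$ is transcendental for all rational numbers $x$ with $0<x<1$, with at most two exceptions; that is, there are at most two rational numbers $x \in (0,1)$ for which $\log\Gamma(x) + \log\Gamma(1-x)$ is algebraic.
   Context: $\Gamma(x) = \int_0^\infty e^{-t} t^{x-1}\,dt$ for $x>0$ is Euler's gamma function, and $\log$ denotes the natural logarithm. A real number is transcendental if it is not algebraic over $\mathbb{Q}$. *)

theory Defs
  imports "HOL-Analysis.Analysis" "HOL-Computational_Algebra.Polynomial"
begin

end

theory Submission
  imports Defs "Jordan_Normal_Form.Char_Poly"
begin

text \<open>
  By the reflection formula the number in question is \<open>L x = ln (pi / sin (pi x))\<close>. If \<open>L x\<close> and
  \<open>L y\<close> are both algebraic, then so are \<open>z = L x - L y\<close> and \<open>exp z = sin (pi y) / sin (pi x)\<close>,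
  so \<open>z = 0\<close> by the Hermite-Lindemann theorem, and \<open>y\<close> is \<open>x\<close> or \<open>1 - x\<close>.

  Hermite-Lindemann for real \<open>z > 0\<close> is proved with the Hermite-Pade approximations of the functions
  \<open>1, exp z, ..., exp (m z)\<close>: an explicit exponential polynomial \<open>G\<close> with \<open>m + 1\<close> polynomial
  coefficients of degree about \<open>n\<close> and a zero of order \<open>t = n (m + 1)\<close> at \<open>0\<close>, hence of size about
  \<open>z^t / t!\<close>. It is a repeated integral of a positive function, so \<open>G z > 0\<close>. If \<open>z\<close> and \<open>exp z\<close>
  were algebraic, then \<open>n! G z\<close> would be an integer polynomial in them with coefficients bounded by
  \<open>n! c^n\<close>, and a Liouville type lower bound \<open>(n!)^(1-N) c^(-n)\<close> would hold with \<open>N\<close> not depending on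
  \<open>m\<close>; for \<open>m = N\<close> and large \<open>n\<close> this contradicts the upper bound.
\<close>

unbundle no vec_syntax

section \<open>Eigenvalues of integer matrices\<close>

text \<open>Compare both sides of the eigenvector equation in a coordinate where the eigenvector has
  maximal modulus; that modulus is positive and cancels.\<close>

lemma norm_eigenvalue_le:
  fixes A :: "complex mat"
  assumes A: "A \<in> carrier_mat n n" and H: "\<And>i j. i < n \<Longrightarrow> j < n \<Longrightarrow> norm (A $$ (i,j)) \<le> H"
    and ev: "eigenvalue A k"
  shows "norm k \<le> real n * H"
proof -
  obtain v where v: "v \<in> carrier_vec n" "v \<noteq> 0\<^sub>v n" "A *\<^sub>v v = k \<cdot>\<^sub>v v"
    using ev A unfolding eigenvalue_def eigenvector_def by auto
  obtain l where l: "l < n" "v $ l \<noteq> 0" using v by (metis carrier_vecD eq_vecI index_zero_vec)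
  define m where "m = Max ((\<lambda>i. norm (v $ i)) ` {..<n})"
  have m_ge: "norm (v $ i) \<le> m" if "i < n" for i using that unfolding m_def by simp
  have "m \<in> (\<lambda>i. norm (v $ i)) ` {..<n}"
    unfolding m_def using l by (intro Max_in) auto
  then obtain i where i: "i < n" "norm (v $ i) = m" by auto
  have m_pos: "m > 0" using m_ge[OF l(1)] l(2) by (smt (verit) zero_less_norm_iff)
  have "k * (v $ i) = (A *\<^sub>v v) $ i" using v i by simp
  also have "\<dots> = (\<Sum>j<n. A $$ (i,j) * (v $ j))"
    using A v(1) i by (simp add: scalar_prod_def atLeast0LessThan)
  finally have "norm k * m = norm (\<Sum>j<n. A $$ (i,j) * (v $ j))" using i by (metis norm_mult)
  also have "\<dots> \<le> (\<Sum>j<n. norm (A $$ (i,j)) * norm (v $ j))"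
    by (rule order_trans[OF norm_sum]) (simp add: norm_mult)
  also have "\<dots> \<le> (\<Sum>j<n. H * m)"
    using H i m_ge m_pos by (intro sum_mono mult_mono) (auto intro: order_trans[OF norm_ge_zero])
  finally show ?thesis using m_pos by (simp flip: mult.assoc)
qed

text \<open>Separating the zero roots as a power of the variable exhibits the lowest nonvanishing
  coefficient of the product as the constant term of the remaining factor.\<close>

lemma prod_list_linear_factors_split:
  "(\<Prod>a\<leftarrow>as. [:- a, 1 :: 'a :: field:]) = monom 1 (count_list as 0) * (\<Prod>a\<leftarrow>filter (\<lambda>a. a \<noteq> 0) as. [:- a, 1:])"
proof (induction as)
  case (Cons a as)
  then show ?case by (simp add: monom_Suc mult.left_commute)
qed simp

lemma coeff_0_prod_list_linear_factors:
  "coeff (\<Prod>a\<leftarrow>as. [:- a, 1 :: 'a :: field:]) 0 = (\<Prod>a\<leftarrow>as. - a)"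
  by (induction as) (simp_all add: coeff_mult)

lemma norm_prod_list_le_power:
  fixes f :: "'a \<Rightarrow> complex"
  assumes "\<And>x. x \<in> set xs \<Longrightarrow> norm (f x) \<le> B"
  shows "norm (\<Prod>x\<leftarrow>xs. f x) \<le> B ^ length xs"
  using assms by (induction xs) (auto simp: norm_mult intro!: mult_mono order_trans[OF norm_ge_zero])

text \<open>The product of the nonzero eigenvalues is, up to sign, a coefficient of the integer
  characteristic polynomial, so its modulus is at least 1.\<close>

lemma integer_matrix_eigenvalue:
  fixes M :: "int mat" and k :: complex
  assumes M: "M \<in> carrier_mat n n" and H: "\<And>i j. i < n \<Longrightarrow> j < n \<Longrightarrow> \<bar>of_int (M $$ (i,j))\<bar> \<le> H"
    and H1: "H \<ge> (1::real)" and ev: "eigenvalue (map_mat of_int M) k"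
  shows "algebraic k" and "k \<noteq> 0 \<Longrightarrow> 1 \<le> norm k * (real n * H) ^ (n - 1)"
proof -
  let ?A = "map_mat of_int M :: complex mat"
  let ?p = "char_poly M"
  let ?cp = "map_poly of_int ?p :: complex poly"
  have A: "?A \<in> carrier_mat n n" using M by simp
  have cp: "char_poly ?A = ?cp"
    by (rule of_int_hom.char_poly_hom[OF M])
  obtain as where as: "char_poly ?A = (\<Prod>a\<leftarrow>as. [:- a, 1:])" and len: "length as = n"
    using char_poly_factorized[OF A] by blast
  have "lead_coeff ?p = 1" using degree_monic_char_poly[OF M] by simp
  hence p0: "?p \<noteq> 0" by auto
  have "poly ?cp k = 0" using ev eigenvalue_root_char_poly[OF A] cp by simp
  thus "algebraic k" using p0 by (intro algebraicI[of ?cp]) auto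
  have root: "eigenvalue ?A a \<longleftrightarrow> a \<in> set as" for a
    unfolding eigenvalue_root_char_poly[OF A] as
    by (auto simp: poly_prod_list o_def prod_list_zero_iff)
  assume k0: "k \<noteq> 0"
  have n: "n > 0" using eigenvalue_imp_nonzero_dim[OF A ev] .
  have B1: "real n * H \<ge> 1" using n H1 by (metis One_nat_def Suc_leI mult_mono' mult_1 of_nat_1 of_nat_mono zero_le_one)
  define bs where "bs = filter (\<lambda>a. a \<noteq> 0) as"
  \<comment> \<open>The multiplicity of the eigenvalue 0 is the index of the lowest coefficient that
    survives.\<close>
  have "coeff ?cp (count_list as 0) = coeff (\<Prod>a\<leftarrow>bs. [:- a, 1:]) 0"
    unfolding cp[symmetric] as bs_def
    by (subst prod_list_linear_factors_split) (simp add: coeff_monom_mult)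
  hence eq: "of_int (coeff ?p (count_list as 0)) = (\<Prod>a\<leftarrow>bs. - a)"
    by (simp add: coeff_0_prod_list_linear_factors)
  have "(\<Prod>a\<leftarrow>bs. - a) \<noteq> 0" unfolding bs_def by (auto simp: prod_list_zero_iff)
  hence "coeff ?p (count_list as 0) \<noteq> 0" using eq by auto
  hence "1 \<le> \<bar>coeff ?p (count_list as 0)\<bar>" by linarith
  hence "1 \<le> norm (of_int (coeff ?p (count_list as 0)) :: complex)"
    by (metis norm_of_int of_int_1_le_iff of_int_abs)
  hence ge1: "1 \<le> norm (\<Prod>a\<leftarrow>bs. - a)" using eq by simp
  have kbs: "k \<in> set bs" using ev k0 root unfolding bs_def by simp
  \<comment> \<open>Taking out one occurrence of \<open>k\<close> leaves at most
    \<open>n - 1\<close> further nonzero eigenvalues, each of modulus at most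
    \<open>real n * H\<close>.\<close>
  then obtain xs ys where bs: "bs = xs @ k # ys" by (meson split_list)
  have le: "norm (- a) \<le> real n * H" if "a \<in> set (xs @ ys)" for a
  proof -
    have "a \<in> set as" using that bs unfolding bs_def
      by (metis Un_iff filter_is_subset in_mono list.set_intros(2) set_append)
    thus ?thesis using norm_eigenvalue_le[OF A, of H a] H M root by simp
  qed
  have "norm (\<Prod>a\<leftarrow>bs. - a) = norm k * norm (\<Prod>a\<leftarrow>xs @ ys. - a)"
    unfolding bs by (simp add: norm_mult)
  also have "\<dots> \<le> norm k * (real n * H) ^ length (xs @ ys)"
    by (intro mult_left_mono norm_prod_list_le_power le) auto
  also have "\<dots> \<le> norm k * (real n * H) ^ (n - 1)"
  proof (intro mult_left_mono power_increasing B1)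
    have "length bs \<le> n" unfolding bs_def len[symmetric] by simp
    thus "length (xs @ ys) \<le> n - 1" using bs by simp
  qed auto
  finally show "1 \<le> norm k * (real n * H) ^ (n - 1)" using ge1 by linarith
qed

text \<open>An enumeration of \<open>I\<close> turns the equations into an eigenvector equation;
  \<open>v i0\<close> keeps the eigenvector from being zero. Arbitrary index sets allow pairs of
  exponents as indices later.\<close>

lemma integer_linear_system_eigenvalue:
  fixes v :: "'i \<Rightarrow> complex" and M :: "'i \<Rightarrow> 'i \<Rightarrow> int"
  assumes fin: "finite I" and nz: "i0 \<in> I" "v i0 \<noteq> 0"
    and eq: "\<And>i. i \<in> I \<Longrightarrow> k * v i = (\<Sum>j\<in>I. of_int (M i j) * v j)"
    and H: "\<And>i j. i \<in> I \<Longrightarrow> j \<in> I \<Longrightarrow> \<bar>of_int (M i j)\<bar> \<le> H" and H1: "H \<ge> (1::real)"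
  shows "algebraic k" and "k \<noteq> 0 \<Longrightarrow> 1 \<le> norm k * (real (card I) * H) ^ (card I - 1)"
proof -
  define n where "n = card I"
  obtain h where h: "bij_betw h {0..<n} I" using ex_bij_betw_nat_finite[OF fin] n_def by blast
  define A where "A = mat n n (\<lambda>(i,j). M (h i) (h j))"
  define w where "w = vec n (\<lambda>i. v (h i))"
  have A: "A \<in> carrier_mat n n" unfolding A_def by simp
  have hI: "h i \<in> I" if "i < n" for i using h that by (auto simp: bij_betw_def)
  obtain l where l: "l < n" "h l = i0" using nz h by (auto simp: bij_betw_def)
  have "w $ l \<noteq> 0" using l nz by (simp add: w_def)
  hence w0: "w \<noteq> 0\<^sub>v n" using l by auto
  have "map_mat of_int A *\<^sub>v w = k \<cdot>\<^sub>v w"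
  proof (rule eq_vecI)
    fix i assume "i < dim_vec (k \<cdot>\<^sub>v w)"
    hence i: "i < n" by (simp add: w_def)
    have "(map_mat of_int A *\<^sub>v w) $ i = (\<Sum>j\<in>{0..<n}. of_int (M (h i) (h j)) * v (h j))"
      using i by (simp add: A_def w_def scalar_prod_def)
    also have "\<dots> = (\<Sum>j\<in>I. of_int (M (h i) j) * v j)"
      by (rule sum.reindex_bij_betw[OF h])
    also have "\<dots> = k * v (h i)" using eq[OF hI[OF i]] by simp
    finally show "(map_mat of_int A *\<^sub>v w) $ i = (k \<cdot>\<^sub>v w) $ i" using i by (simp add: w_def)
  qed (simp add: A_def w_def)
  hence ev: "eigenvalue (map_mat of_int A) k"
    unfolding eigenvalue_def eigenvector_def using w0 by (intro exI[of _ w]) (simp add: A_def w_def)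
  have H': "\<bar>of_int (A $$ (i,j))\<bar> \<le> H" if "i < n" "j < n" for i j
    using that H hI by (simp add: A_def)
  note * = integer_matrix_eigenvalue[OF A H' H1 ev]
  show "algebraic k" by (rule *(1))
  show "k \<noteq> 0 \<Longrightarrow> 1 \<le> norm k * (real (card I) * H) ^ (card I - 1)"
    using *(2) unfolding n_def .
qed

section \<open>A Liouville type lower bound for integer polynomials in two algebraic numbers\<close>

text \<open>If \<open>l\<close> is the leading coefficient of an integer polynomial of degree
  \<open>d\<close> with root \<open>a\<close>, then \<open>l * a ^ d\<close> is an integer
  combination of lower powers. Each multiplication by \<open>l * a\<close> can thus be reduced
  again, at the cost of one factor \<open>C\<close>. The common denominator \<open>L ^ T\<close>
  serves all powers up to \<open>T\<close> at once.\<close>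

lemma algebraic_power_reduce:
  fixes a :: complex
  assumes "algebraic a"
  obtains d :: nat and L :: int and C :: real where "d > 0" "L \<ge> 1" "C \<ge> 1"
    "\<And>T k. k \<le> T \<Longrightarrow> \<exists>c. of_int L ^ T * a ^ k = (\<Sum>i<d. of_int (c i) * a ^ i)
              \<and> (\<forall>i<d. \<bar>of_int (c i)\<bar> \<le> C ^ T)"
proof -
  obtain p0 :: "int poly" where p0: "p0 \<noteq> 0" "poly (map_poly of_int p0) a = 0"
    using assms by (rule algebraicE')
  \<comment> \<open>The sign is normalized so that the leading coefficient is positive.\<close>
  define p where "p = Polynomial.smult (sgn (lead_coeff p0)) p0"
  define l where "l = lead_coeff p"
  define d where "d = degree p"
  have s: "sgn (lead_coeff p0) \<noteq> 0" using p0 by (simp add: sgn_eq_0_iff)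
  have "l = \<bar>lead_coeff p0\<bar>" unfolding l_def p_def by (simp add: abs_sgn mult.commute)
  hence l1: "l \<ge> 1" using p0 by (smt (verit) leading_coeff_0_iff)
  have root: "poly (map_poly of_int p) a = 0"
  proof -
    have "map_poly of_int p = Polynomial.smult (of_int (sgn (lead_coeff p0)) :: complex) (map_poly of_int p0)"
      by (intro poly_eqI) (simp add: p_def coeff_map_poly)
    thus ?thesis using p0 by simp
  qed
  have pa: "poly (map_poly of_int p) a = (\<Sum>i\<le>d. of_int (coeff p i) * a ^ i)"
    unfolding d_def poly_altdef by (simp add: degree_map_poly)
  have d0: "d > 0"
  proof (rule ccontr)
    assume "\<not> d > 0"
    hence "of_int l = (0::complex)" using root pa unfolding l_def d_def by simp
    thus False using l1 by simp
  qed
  have top: "of_int l * a ^ d = - (\<Sum>i<d. of_int (coeff p i) * a ^ i)"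
  proof -
    have "(\<Sum>i\<le>d. of_int (coeff p i) * a ^ i) = (\<Sum>i<d. of_int (coeff p i) * a ^ i) + of_int l * a ^ d"
      unfolding l_def d_def by (simp flip: lessThan_Suc_atMost)
    thus ?thesis using root pa by (simp add: eq_neg_iff_add_eq_0 add.commute)
  qed
  \<comment> \<open>In one multiplication by \<open>l * a\<close> a coefficient grows by at most
    \<open>l\<close> (from the shift) plus one \<open>\<bar>coeff p i\<bar>\<close> (from reducing
    the top term); the sum dominates this for every \<open>i\<close>.\<close>
  define C where "C = real_of_int (l + (\<Sum>i<d. \<bar>coeff p i\<bar>))"
  have Cl: "real_of_int l \<le> C" unfolding C_def by (simp add: sum_nonneg)
  hence C1: "C \<ge> 1" using l1 by linarith
  have ex: "\<exists>c. of_int l ^ k * a ^ k = (\<Sum>i<d. of_int (c i) * a ^ i) \<and> (\<forall>i<d. \<bar>real_of_int (c i)\<bar> \<le> C ^ k)" for k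
  proof (induction k)
    case 0
    have "(\<Sum>i<d. of_int (if i = 0 then 1 else 0) * a ^ i) = (\<Sum>i<d. if i = 0 then 1 else 0)"
      by (intro sum.cong) auto
    also have "\<dots> = 1" using d0 by simp
    finally show ?case by (intro exI[of _ "\<lambda>i. if i = 0 then 1 else 0"]) auto
  next
    case (Suc k)
    then obtain c where c: "of_int l ^ k * a ^ k = (\<Sum>i<d. of_int (c i) * a ^ i)"
      and cb: "\<And>i. i < d \<Longrightarrow> \<bar>real_of_int (c i)\<bar> \<le> C ^ k" by blast
    obtain e where e: "d = Suc e" using d0 by (cases d) auto
    \<comment> \<open>Multiplication by \<open>l * a\<close> shifts the coefficients; the
      overflowing term, with coefficient \<open>c e\<close> where \<open>e = d - 1\<close>, is
      rewritten by \<open>top\<close>.\<close>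
    define c' where "c' i = (if i = 0 then 0 else l * c (i - 1)) - c e * coeff p i" for i
    have "of_int l ^ Suc k * a ^ Suc k = of_int l * a * (\<Sum>i<d. of_int (c i) * a ^ i)"
      by (subst c[symmetric]) (simp add: algebra_simps)
    also have "\<dots> = (\<Sum>i<e. of_int (l * c i) * a ^ Suc i) + of_int (c e) * (of_int l * a ^ d)"
      unfolding e by (simp add: sum_distrib_left algebra_simps)
    also have "(\<Sum>i<e. of_int (l * c i) * a ^ Suc i) = (\<Sum>i<d. of_int (if i = 0 then 0 else l * c (i - 1)) * a ^ i)"
      unfolding e by (subst sum.lessThan_Suc_shift) simp
    also have "of_int (c e) * (of_int l * a ^ d) = - (\<Sum>i<d. of_int (c e * coeff p i) * a ^ i)"
      unfolding top by (simp add: sum_distrib_left mult.assoc)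
    also have "(\<Sum>i<d. of_int (if i = 0 then 0 else l * c (i - 1)) * a ^ i) + - (\<Sum>i<d. of_int (c e * coeff p i) * a ^ i)
        = (\<Sum>i<d. of_int (c' i) * a ^ i)"
      unfolding c'_def by (simp add: left_diff_distrib sum_subtractf)
    finally have 1: "of_int l ^ Suc k * a ^ Suc k = (\<Sum>i<d. of_int (c' i) * a ^ i)" .
    have 2: "\<bar>real_of_int (c' i)\<bar> \<le> C ^ Suc k" if i: "i < d" for i
    proof -
      have "\<bar>real_of_int (c' i)\<bar> \<le> real_of_int l * C ^ k + C ^ k * \<bar>real_of_int (coeff p i)\<bar>"
      proof -
        have "\<bar>real_of_int (if i = 0 then 0 else l * c (i - 1))\<bar> \<le> real_of_int l * C ^ k"
          using l1 C1 i cb[of "i - 1"] by (auto simp: abs_mult)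
        moreover have "\<bar>real_of_int (c e * coeff p i)\<bar> \<le> C ^ k * \<bar>real_of_int (coeff p i)\<bar>"
          using cb[of e] e by (auto simp: abs_mult intro!: mult_right_mono)
        ultimately show ?thesis unfolding c'_def by (smt (verit) of_int_diff)
      qed
      also have "\<dots> = C ^ k * real_of_int (l + \<bar>coeff p i\<bar>)" by (simp add: algebra_simps)
      also have "\<dots> \<le> C ^ k * C"
      proof (rule mult_left_mono)
        have "\<bar>coeff p i\<bar> \<le> (\<Sum>i<d. \<bar>coeff p i\<bar>)" using i by (intro member_le_sum) auto
        thus "real_of_int (l + \<bar>coeff p i\<bar>) \<le> C" unfolding C_def by (subst of_int_le_iff) simp
      qed (use C1 in simp)
      finally show ?thesis by (simp add: mult.commute)
    qed
    show ?case using 1 2 by blast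
  qed
  show thesis
  proof (rule that[OF d0 l1 C1])
    fix T k :: nat assume kT: "k \<le> T"
    obtain c where c: "of_int l ^ k * a ^ k = (\<Sum>i<d. of_int (c i) * a ^ i)"
      and cb: "\<And>i. i < d \<Longrightarrow> \<bar>real_of_int (c i)\<bar> \<le> C ^ k" using ex by blast
    have "of_int l ^ T * a ^ k = of_int l ^ (T - k) * (of_int l ^ k * a ^ k)"
      using kT by (simp flip: mult.assoc power_add)
    also have "\<dots> = (\<Sum>i<d. of_int (l ^ (T - k) * c i) * a ^ i)"
      unfolding c by (simp add: sum_distrib_left mult.assoc)
    finally have 1: "of_int l ^ T * a ^ k = (\<Sum>i<d. of_int (l ^ (T - k) * c i) * a ^ i)" .
    have 2: "\<bar>of_int (l ^ (T - k) * c i)\<bar> \<le> C ^ T" if "i < d" for i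
    proof -
      have "\<bar>of_int (l ^ (T - k) * c i)\<bar> = real_of_int l ^ (T - k) * \<bar>of_int (c i)\<bar>"
        using l1 by (simp add: abs_mult power_abs)
      also have "\<dots> \<le> C ^ (T - k) * C ^ k"
        using l1 C1 Cl cb[OF that] by (intro mult_mono power_mono) auto
      finally show ?thesis using kT by (simp flip: power_add)
    qed
    show "\<exists>c. of_int l ^ T * a ^ k = (\<Sum>i<d. of_int (c i) * a ^ i) \<and> (\<forall>i<d. \<bar>of_int (c i)\<bar> \<le> C ^ T)"
      by (intro exI[of _ "\<lambda>i. l ^ (T - k) * c i"] conjI allI impI 1 2)
  qed
qed

text \<open>Substitute \<open>m\<close> times the variable into a polynomial that vanishes at the
  multiple.\<close>

lemma algebraic_of_int_mult_cancel:
  fixes x :: "'a :: field_char_0"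
  assumes "algebraic (of_int m * x)" "m \<noteq> 0"
  shows "algebraic x"
proof -
  obtain p where p: "\<And>i. coeff p i \<in> \<int>" "p \<noteq> 0" "poly p (of_int m * x) = 0"
    using assms(1) by (elim algebraicE) blast
  show ?thesis
  proof (rule algebraicI)
    let ?q = "pcompose p [:0, of_int m:]"
    show "coeff ?q i \<in> \<int>" for i using p(1) by (simp add: coeff_pcompose_linear)
    show "?q \<noteq> 0" using p(2) assms(2) by (simp add: pcompose_eq_0_iff)
    show "poly ?q x = 0" using p(3) by (simp add: poly_pcompose mult.commute)
  qed
qed

text \<open>A suitable integer multiple of \<open>k\<close> acts by an integer matrix on the span of the monomials
  \<open>a^i * b^j\<close> with \<open>i\<close> and \<open>j\<close> below the degrees of \<open>a\<close> and \<open>b\<close>.\<close>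

lemma bivariate_int_polynomial_lower_bound:
  fixes a b :: complex
  assumes "algebraic a" "algebraic b"
  obtains N :: nat and C :: real where "N \<ge> 1" "C \<ge> 1"
    "\<And>T K q S k. finite K \<Longrightarrow> (\<And>x. x \<in> K \<Longrightarrow> fst x \<le> T \<and> snd x \<le> T) \<Longrightarrow>
       (\<Sum>x\<in>K. \<bar>real_of_int (q x)\<bar>) \<le> S \<Longrightarrow> 1 \<le> S \<Longrightarrow>
       k = (\<Sum>x\<in>K. of_int (q x) * a ^ fst x * b ^ snd x) \<Longrightarrow>
       algebraic k \<and> (k \<noteq> 0 \<longrightarrow> 1 \<le> norm k * C ^ (T + 1) * S ^ (N - 1))"
proof -
  obtain d1 L1 C1 where 1: "d1 > 0" "L1 \<ge> 1" "C1 \<ge> 1"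
    and red1: "\<And>T k. k \<le> T \<Longrightarrow> \<exists>c. of_int L1 ^ T * a ^ k = (\<Sum>i<d1. of_int (c i) * a ^ i)
              \<and> (\<forall>i<d1. \<bar>real_of_int (c i)\<bar> \<le> C1 ^ T)"
    by (rule algebraic_power_reduce[OF assms(1)]) (rule that; blast)
  obtain d2 L2 C2 where 2: "d2 > 0" "L2 \<ge> 1" "C2 \<ge> 1"
    and red2: "\<And>T k. k \<le> T \<Longrightarrow> \<exists>c. of_int L2 ^ T * b ^ k = (\<Sum>i<d2. of_int (c i) * b ^ i)
              \<and> (\<forall>i<d2. \<bar>real_of_int (c i)\<bar> \<le> C2 ^ T)"
    by (rule algebraic_power_reduce[OF assms(2)]) (rule that; blast)
  define N where "N = d1 * d2"
  define R where "R = L1 * L2"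
  \<comment> \<open>\<open>Q\<close> dominates both \<open>R\<close> and
    \<open>real N * (C1 * C2)\<close>. The exponent in \<open>C\<close> comes from
    \<open>T + d1 + d2 \<le> (d1 + d2 + 1) * (T + 1)\<close>, which makes the final bound a power of
    a constant independent of \<open>T\<close>.\<close>
  define Q where "Q = real_of_int R * real N * (C1 * C2)"
  define C where "C = Q ^ ((d1 + d2 + 1) * N)"
  have ge1: "1 \<le> x * y" if "1 \<le> x" "1 \<le> y" for x y :: real
    using mult_mono[of 1 x 1 y] that by simp
  have N1: "N \<ge> 1" using 1 2 by (simp add: N_def Suc_le_eq)
  have R1: "R \<ge> 1" using mult_mono[of 1 L1 1 L2] 1 2 by (simp add: R_def)
  have C12: "C1 * C2 \<ge> 1" using 1 2 ge1 by blast
  have RN: "real_of_int R * real N \<ge> 1"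
    using R1 N1 by (intro ge1) auto
  have Q1: "Q \<ge> 1" unfolding Q_def using RN C12 by (rule ge1)
  have C_1: "C \<ge> 1" unfolding C_def using Q1 by simp
  have RQ: "real_of_int R \<le> Q"
  proof -
    have "real N * (C1 * C2) \<ge> 1" using ge1[of "real N", OF _ C12] N1 by simp
    thus ?thesis unfolding Q_def mult.assoc using R1 by (simp add: mult_le_cancel_left1)
  qed
  have NQ: "real N * (C1 * C2) \<le> Q"
    unfolding Q_def mult.assoc using R1 C12 N1 mult_right_mono[of 1 "real_of_int R" "real N * (C1 * C2)"] by simp
  show thesis
  proof (rule that[OF N1 C_1])
    fix T :: nat and K :: "(nat \<times> nat) set" and q :: "nat \<times> nat \<Rightarrow> int" and S :: real and k :: complex
    assume K: "finite K" "\<And>x. x \<in> K \<Longrightarrow> fst x \<le> T \<and> snd x \<le> T"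
      and S: "(\<Sum>x\<in>K. \<bar>real_of_int (q x)\<bar>) \<le> S" "1 \<le> S"
      and k: "k = (\<Sum>x\<in>K. of_int (q x) * a ^ fst x * b ^ snd x)"
    \<comment> \<open>A monomial from \<open>K\<close> times a basis monomial has exponents below
      \<open>T + d1\<close> and \<open>T + d2\<close>; \<open>U\<close> bounds both.\<close>
    define U where "U = T + d1 + d2"
    have "\<forall>k. \<exists>c. k \<le> U \<longrightarrow> of_int L1 ^ U * a ^ k = (\<Sum>i<d1. of_int (c i) * a ^ i) \<and> (\<forall>i<d1. \<bar>real_of_int (c i)\<bar> \<le> C1 ^ U)"
      using red1[of _ U] by blast
    then obtain c1 where "\<forall>k. k \<le> U \<longrightarrow> of_int L1 ^ U * a ^ k = (\<Sum>i<d1. of_int (c1 k i) * a ^ i) \<and> (\<forall>i<d1. \<bar>real_of_int (c1 k i)\<bar> \<le> C1 ^ U)"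
      by (rule choice[THEN exE])
    hence c1: "\<And>k. k \<le> U \<Longrightarrow> of_int L1 ^ U * a ^ k = (\<Sum>i<d1. of_int (c1 k i) * a ^ i)"
      and c1b: "\<And>k i. k \<le> U \<Longrightarrow> i < d1 \<Longrightarrow> \<bar>real_of_int (c1 k i)\<bar> \<le> C1 ^ U"
      by blast+
    have "\<forall>k. \<exists>c. k \<le> U \<longrightarrow> of_int L2 ^ U * b ^ k = (\<Sum>i<d2. of_int (c i) * b ^ i) \<and> (\<forall>i<d2. \<bar>real_of_int (c i)\<bar> \<le> C2 ^ U)"
      using red2[of _ U] by blast
    then obtain c2 where "\<forall>k. k \<le> U \<longrightarrow> of_int L2 ^ U * b ^ k = (\<Sum>i<d2. of_int (c2 k i) * b ^ i) \<and> (\<forall>i<d2. \<bar>real_of_int (c2 k i)\<bar> \<le> C2 ^ U)"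
      by (rule choice[THEN exE])
    hence c2: "\<And>k. k \<le> U \<Longrightarrow> of_int L2 ^ U * b ^ k = (\<Sum>i<d2. of_int (c2 k i) * b ^ i)"
      and c2b: "\<And>k i. k \<le> U \<Longrightarrow> i < d2 \<Longrightarrow> \<bar>real_of_int (c2 k i)\<bar> \<le> C2 ^ U"
      by blast+
    define I where "I = {..<d1} \<times> {..<d2}"
    define v where "v x = a ^ fst x * b ^ snd x" for x :: "nat \<times> nat"
    \<comment> \<open>This is the matrix of multiplication by \<open>R ^ U * k\<close> on the basis
      monomials; \<open>R ^ U\<close> supplies the denominators needed for the powers of
      \<open>a\<close> and of \<open>b\<close>.\<close>
    define M where "M i j = (\<Sum>x\<in>K. q x * (c1 (fst x + fst i) (fst j) * c2 (snd x + snd i) (snd j)))"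
      for i j :: "nat \<times> nat"
    have eq: "of_int (R ^ U) * k * v i = (\<Sum>j\<in>I. of_int (M i j) * v j)" if i: "i \<in> I" for i
    proof -
      have "of_int (R ^ U) * k * v i = (\<Sum>x\<in>K. of_int (q x) *
          ((of_int L1 ^ U * a ^ (fst x + fst i)) * (of_int L2 ^ U * b ^ (snd x + snd i))))"
        unfolding k R_def v_def by (simp add: sum_distrib_left sum_distrib_right power_add power_mult_distrib mult_ac)
      also have "\<dots> = (\<Sum>x\<in>K. of_int (q x) * (\<Sum>j\<in>I.
          of_int (c1 (fst x + fst i) (fst j) * c2 (snd x + snd i) (snd j)) * v j))"
      proof (intro sum.cong refl arg_cong2[of _ _ _ _ "(*)"])
        fix x assume x: "x \<in> K"
        have "fst x + fst i \<le> U" "snd x + snd i \<le> U" using K(2)[OF x] i unfolding I_def U_def by auto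
        hence "of_int L1 ^ U * a ^ (fst x + fst i) * (of_int L2 ^ U * b ^ (snd x + snd i)) =
          (\<Sum>i'<d1. of_int (c1 (fst x + fst i) i') * a ^ i') * (\<Sum>j'<d2. of_int (c2 (snd x + snd i) j') * b ^ j')"
          by (simp add: c1 c2)
        also have "\<dots> = (\<Sum>j\<in>I. of_int (c1 (fst x + fst i) (fst j) * c2 (snd x + snd i) (snd j)) * v j)"
          unfolding sum_product I_def v_def sum.cartesian_product
          by (intro sum.cong) (auto simp: mult_ac)
        finally show "of_int L1 ^ U * a ^ (fst x + fst i) * (of_int L2 ^ U * b ^ (snd x + snd i)) =
          (\<Sum>j\<in>I. of_int (c1 (fst x + fst i) (fst j) * c2 (snd x + snd i) (snd j)) * v j)" .
      qed
      also have "\<dots> = (\<Sum>j\<in>I. of_int (M i j) * v j)"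
        unfolding M_def by (simp add: sum_distrib_left sum_distrib_right mult.assoc) (rule sum.swap)
      finally show ?thesis .
    qed
    have P1: "(C1 * C2) ^ U \<ge> 1" using C12 by simp
    have Mb: "\<bar>of_int (M i j)\<bar> \<le> S * (C1 * C2) ^ U" if i: "i \<in> I" and j: "j \<in> I" for i j
    proof -
      have "\<bar>real_of_int (M i j)\<bar> \<le> (\<Sum>x\<in>K. \<bar>real_of_int (q x * (c1 (fst x + fst i) (fst j) * c2 (snd x + snd i) (snd j)))\<bar>)"
        unfolding M_def of_int_sum by (rule sum_abs)
      also have "\<dots> \<le> (\<Sum>x\<in>K. \<bar>real_of_int (q x)\<bar> * (C1 ^ U * C2 ^ U))"
      proof (rule sum_mono)
        fix x assume x: "x \<in> K"
        have "fst x + fst i \<le> U" "snd x + snd i \<le> U" using K(2)[OF x] i unfolding I_def U_def by auto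
        thus "\<bar>real_of_int (q x * (c1 (fst x + fst i) (fst j) * c2 (snd x + snd i) (snd j)))\<bar>
            \<le> \<bar>real_of_int (q x)\<bar> * (C1 ^ U * C2 ^ U)"
          unfolding of_int_mult abs_mult using j 1 2 unfolding I_def
          by (intro mult_left_mono mult_mono c1b c2b) auto
      qed
      also have "\<dots> = (\<Sum>x\<in>K. \<bar>real_of_int (q x)\<bar>) * (C1 * C2) ^ U"
        by (simp add: sum_distrib_right power_mult_distrib)
      also have "\<dots> \<le> S * (C1 * C2) ^ U" using S P1 by (intro mult_right_mono) auto
      finally show ?thesis .
    qed
    have S1: "1 \<le> S * (C1 * C2) ^ U" using S(2) P1 by (rule ge1)
    have fin: "finite I" "(0, 0) \<in> I" "v (0, 0) \<noteq> 0" and card: "card I = N"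
      using 1 2 by (auto simp: I_def v_def N_def)
    note sys = integer_linear_system_eigenvalue[OF fin eq Mb S1, unfolded card]
    have RU: "R ^ U \<noteq> 0" using R1 by simp
    have "algebraic k" using algebraic_of_int_mult_cancel[OF sys(1) RU] by simp
    moreover have "1 \<le> norm k * C ^ (T + 1) * S ^ (N - 1)" if "k \<noteq> 0"
    proof -
      have "1 \<le> norm (of_int (R ^ U) * k) * (real N * (S * (C1 * C2) ^ U)) ^ (N - 1)"
        using sys(2) that RU by simp
      also have "\<dots> = norm k * (real_of_int R ^ U * (real N * (C1 * C2) ^ U) ^ (N - 1)) * S ^ (N - 1)"
        using R1 by (simp add: norm_mult norm_power power_mult_distrib)
      also have "\<dots> \<le> norm k * C ^ (T + 1) * S ^ (N - 1)"
      proof (intro mult_right_mono mult_left_mono)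
        have "real N \<le> real N ^ U" using N1 1 unfolding U_def by (intro self_le_power) auto
        hence "real N * (C1 * C2) ^ U \<le> real N ^ U * (C1 * C2) ^ U" using P1 by (intro mult_right_mono) auto
        also have "\<dots> \<le> Q ^ U" unfolding power_mult_distrib[symmetric]
          using NQ C12 N1 by (intro power_mono) auto
        finally have *: "real N * (C1 * C2) ^ U \<le> Q ^ U" .
        have "real_of_int R ^ U * (real N * (C1 * C2) ^ U) ^ (N - 1) \<le> Q ^ U * (Q ^ U) ^ (N - 1)"
          using RQ R1 Q1 P1 * by (intro mult_mono power_mono) auto
        also have "\<dots> = Q ^ (U * N)" using N1 by (cases N) (simp_all add: power_add power_mult)
        also have "\<dots> \<le> Q ^ ((d1 + d2 + 1) * N * (T + 1))"
          using Q1 unfolding U_def by (intro power_increasing) (auto simp: algebra_simps)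
        also have "\<dots> = C ^ (T + 1)" unfolding C_def power_mult by simp
        finally show "real_of_int R ^ U * (real N * (C1 * C2) ^ U) ^ (N - 1) \<le> C ^ (T + 1)" .
      qed (use S in auto)
      finally show ?thesis .
    qed
    ultimately show "algebraic k \<and> (k \<noteq> 0 \<longrightarrow> 1 \<le> norm k * C ^ (T + 1) * S ^ (N - 1))" by blast
  qed
qed

section \<open>Sums and products of algebraic numbers\<close>

text \<open>The sum is a value of an integer polynomial in \<open>a\<close> and \<open>b\<close>
  with exponent pairs \<open>(1, 0)\<close> and \<open>(0, 1)\<close>, so the preceding eigenvalue
  argument applies; products use the pair \<open>(1, 1)\<close> in the same way.\<close>

lemma algebraic_add:
  assumes "algebraic a" "algebraic (b :: complex)"
  shows "algebraic (a + b)"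
proof -
  obtain N C where *: "\<And>T K q S k. finite K \<Longrightarrow> (\<And>x. x \<in> K \<Longrightarrow> fst x \<le> T \<and> snd x \<le> T) \<Longrightarrow>
       (\<Sum>x\<in>K. \<bar>real_of_int (q x)\<bar>) \<le> S \<Longrightarrow> 1 \<le> S \<Longrightarrow>
       k = (\<Sum>x\<in>K. of_int (q x) * a ^ fst x * b ^ snd x) \<Longrightarrow>
       algebraic k \<and> (k \<noteq> 0 \<longrightarrow> 1 \<le> norm k * C ^ (T + 1) * S ^ (N - 1))"
    by (rule bivariate_int_polynomial_lower_bound[OF assms]) blast
  show ?thesis
    by (rule *[THEN conjunct1, of "{(1, 0), (0, 1)}" 1 "\<lambda>_. 1" 2]) auto
qed

lemma algebraic_mult:
  assumes "algebraic a" "algebraic (b :: complex)"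
  shows "algebraic (a * b)"
proof -
  obtain N C where *: "\<And>T K q S k. finite K \<Longrightarrow> (\<And>x. x \<in> K \<Longrightarrow> fst x \<le> T \<and> snd x \<le> T) \<Longrightarrow>
       (\<Sum>x\<in>K. \<bar>real_of_int (q x)\<bar>) \<le> S \<Longrightarrow> 1 \<le> S \<Longrightarrow>
       k = (\<Sum>x\<in>K. of_int (q x) * a ^ fst x * b ^ snd x) \<Longrightarrow>
       algebraic k \<and> (k \<noteq> 0 \<longrightarrow> 1 \<le> norm k * C ^ (T + 1) * S ^ (N - 1))"
    by (rule bivariate_int_polynomial_lower_bound[OF assms]) blast
  show ?thesis
    by (rule *[THEN conjunct1, of "{(1, 1)}" 1 "\<lambda>_. 1" 1]) auto
qed

section \<open>Hermite-Pade approximations as exponential polynomials\<close>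

text \<open>Scaling the variable by \<open>D\<close> (later \<open>m!\<close>) and using divided powers keeps all coefficients
  integral under the integration step below.\<close>

definition exp_poly :: "nat \<Rightarrow> nat \<Rightarrow> nat \<Rightarrow> (nat \<Rightarrow> nat \<Rightarrow> int) \<Rightarrow> real \<Rightarrow> real" where
  "exp_poly m n D a z = (\<Sum>j\<le>m. (\<Sum>i<n. of_int (a j i) * (real D * z) ^ i / fact i) * exp (real j * z))"

text \<open>The weight \<open>2 * D\<close> per degree is matched to the integration step, which
  then multiplies the total by at most \<open>2 * D\<close>: a shift by one degree costs this
  factor, and the 2 leaves room for counting a lowest coefficient twice.\<close>

definition coeff_weight :: "nat \<Rightarrow> nat \<Rightarrow> nat \<Rightarrow> (nat \<Rightarrow> nat \<Rightarrow> int) \<Rightarrow> int" where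
  "coeff_weight m n D a = (\<Sum>j\<le>m. \<Sum>i<n. \<bar>a j i\<bar> * (2 * int D) ^ i)"

text \<open>On divided powers differentiation is a shift of the coefficients; \<open>c n = 0\<close>
  lets the shifted sum keep the range \<open>i < n\<close>.\<close>

lemma has_real_derivative_divided_power_sum:
  fixes c :: "nat \<Rightarrow> int"
  assumes "c n = 0"
  shows "((\<lambda>z. \<Sum>i<n. of_int (c i) * (D * z) ^ i / fact i) has_real_derivative
           (\<Sum>i<n. D * of_int (c (Suc i)) * (D * z) ^ i / fact i)) (at z)"
proof (cases n)
  case (Suc l)
  have "((\<lambda>z. of_int (c (Suc i)) * (D * z) ^ Suc i / fact (Suc i)) has_real_derivative
         D * of_int (c (Suc i)) * (D * z) ^ i / fact i) (at z)" for i
    by (rule derivative_eq_intros refl | simp)+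
  hence "((\<lambda>z. \<Sum>i<l. of_int (c (Suc i)) * (D * z) ^ Suc i / fact (Suc i)) has_real_derivative
         (\<Sum>i<l. D * of_int (c (Suc i)) * (D * z) ^ i / fact i)) (at z)"
    by (intro DERIV_sum) auto
  hence "((\<lambda>z. of_int (c 0) + (\<Sum>i<l. of_int (c (Suc i)) * (D * z) ^ Suc i / fact (Suc i))) has_real_derivative
         0 + (\<Sum>i<l. D * of_int (c (Suc i)) * (D * z) ^ i / fact i)) (at z)"
    by (intro DERIV_add DERIV_const)
  thus ?thesis using assms unfolding Suc by (subst sum.lessThan_Suc_shift) simp
qed simp

text \<open>With \<open>E = D / (j - k)\<close> the recurrence is the coefficient form of
  \<open>P' + (j - k) * P = D * A\<close>, where \<open>A\<close> and \<open>P\<close> have the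
  divided power coefficients \<open>a\<close> and \<open>q\<close> in \<open>D * z\<close>. It is
  solved downwards from degree \<open>b\<close>. The additional \<open>\<bar>q 0\<bar>\<close> pays
  for the integration constant chosen in the next lemma.\<close>

lemma twisted_antiderivative_coeffs:
  fixes a :: "nat \<Rightarrow> int" and E D :: int
  assumes "\<And>i. b \<le> i \<Longrightarrow> a i = 0" "\<bar>E\<bar> \<le> D"
  shows "\<exists>q. (\<forall>i. q i = E * (a i - q (Suc i))) \<and> (\<forall>i\<ge>b. q i = 0) \<and>
           \<bar>q 0\<bar> + (\<Sum>i<b. \<bar>q i\<bar> * (2 * D) ^ i) \<le> 2 * D * (\<Sum>i<b. \<bar>a i\<bar> * (2 * D) ^ i)"
  using assms(1)
proof (induction b arbitrary: a)
  case 0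
  thus ?case by (intro exI[of _ "\<lambda>_. 0"]) auto
next
  case (Suc b)
  have "\<exists>q. (\<forall>i. q i = E * (a (Suc i) - q (Suc i))) \<and> (\<forall>i\<ge>b. q i = 0) \<and>
     \<bar>q 0\<bar> + (\<Sum>i<b. \<bar>q i\<bar> * (2 * D) ^ i) \<le> 2 * D * (\<Sum>i<b. \<bar>a (Suc i)\<bar> * (2 * D) ^ i)"
    by (rule Suc.IH) (simp add: Suc.prems)
  then obtain q where q: "\<And>i. q i = E * (a (Suc i) - q (Suc i))" "\<And>i. i \<ge> b \<Longrightarrow> q i = 0"
    and le: "\<bar>q 0\<bar> + (\<Sum>i<b. \<bar>q i\<bar> * (2 * D) ^ i) \<le> 2 * D * (\<Sum>i<b. \<bar>a (Suc i)\<bar> * (2 * D) ^ i)"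
    by blast
  \<comment> \<open>The solution for the shifted sequence is preceded by the value that the
    recurrence forces at index 0.\<close>
  define p where "p = case_nat (E * (a 0 - q 0)) q"
  have D0: "D \<ge> 0" using assms(2) by linarith
  have "\<bar>p 0\<bar> \<le> D * (\<bar>a 0\<bar> + \<bar>q 0\<bar>)"
    unfolding p_def using assms(2) D0 by (auto simp: abs_mult intro!: mult_mono)
  moreover have "(\<Sum>i<Suc b. \<bar>p i\<bar> * (2 * D) ^ i) = \<bar>p 0\<bar> + 2 * D * (\<Sum>i<b. \<bar>q i\<bar> * (2 * D) ^ i)"
    unfolding sum.lessThan_Suc_shift by (simp add: p_def sum_distrib_left mult_ac)
  moreover have "2 * D * (\<Sum>i<Suc b. \<bar>a i\<bar> * (2 * D) ^ i) = 2 * (D * \<bar>a 0\<bar>) + 2 * D * (2 * D * (\<Sum>i<b. \<bar>a (Suc i)\<bar> * (2 * D) ^ i))"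
    unfolding sum.lessThan_Suc_shift by (simp add: sum_distrib_left distrib_left mult_ac)
  moreover have "2 * D * (\<bar>q 0\<bar> + (\<Sum>i<b. \<bar>q i\<bar> * (2 * D) ^ i)) \<le> 2 * D * (2 * D * (\<Sum>i<b. \<bar>a (Suc i)\<bar> * (2 * D) ^ i))"
    using D0 by (intro mult_left_mono le) auto
  ultimately have "\<bar>p 0\<bar> + (\<Sum>i<Suc b. \<bar>p i\<bar> * (2 * D) ^ i) \<le> 2 * D * (\<Sum>i<Suc b. \<bar>a i\<bar> * (2 * D) ^ i)"
    unfolding distrib_left by linarith
  moreover have "\<forall>i. p i = E * (a i - p (Suc i))"
  proof
    fix i
    show "p i = E * (a i - p (Suc i))"
    proof (cases i)
      case (Suc l)
      thus ?thesis using q(1)[of l] by (simp add: p_def)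
    qed (simp add: p_def)
  qed
  moreover have "\<forall>i\<ge>Suc b. p i = 0"
    using q(2) by (auto simp: p_def split: nat.splits)
  ultimately show ?case by blast
qed

text \<open>The new function is \<open>D\<close> times the integral of \<open>exp (k * (z - s)) * G s\<close> over \<open>s\<close> from 0 to
  \<open>z\<close>, where \<open>G\<close> is the old one; only the coefficient of \<open>exp (k * z)\<close> gains a degree.\<close>

lemma exp_poly_twisted_antiderivative:
  fixes a :: "nat \<Rightarrow> nat \<Rightarrow> int"
  assumes supp: "\<And>j i. B j \<le> i \<Longrightarrow> a j i = 0" and Bn: "\<And>j. B j \<le> n" "Suc (B k) \<le> n" and k: "k \<le> m"
    and D: "D = fact m"
  obtains a' where "\<And>j i. (B(k := Suc (B k))) j \<le> i \<Longrightarrow> a' j i = 0"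
    "coeff_weight m n D a' \<le> 2 * int D * coeff_weight m n D a"
    "exp_poly m n D a' 0 = 0"
    "\<And>z. (exp_poly m n D a' has_real_derivative real k * exp_poly m n D a' z + real D * exp_poly m n D a z) (at z)"
proof -
  \<comment> \<open>\<open>D = fact m\<close> is divisible by every nonzero \<open>j - k\<close>, so
    the quotient is exact. The value 0 elsewhere makes the bound
    \<open>\<bar>E j\<bar> \<le> D\<close> hold for all \<open>j\<close>.\<close>
  define E where "E j = (if j \<le> m \<and> j \<noteq> k then int D div (int j - int k) else 0)" for j
  have Emult: "E j * (int j - int k) = int D" if "j \<le> m" "j \<noteq> k" for j
  proof -
    have "nat \<bar>int j - int k\<bar> dvd fact m"
      using that k by (intro dvd_fact) auto
    hence "int (nat \<bar>int j - int k\<bar>) dvd int D" unfolding D by (simp only: int_dvd_int_iff)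
    hence "(int j - int k) dvd int D" by simp
    thus ?thesis using that by (simp add: E_def)
  qed
  have Eabs: "\<bar>E j\<bar> \<le> int D" for j
  proof (cases "j \<le> m \<and> j \<noteq> k")
    case True
    hence "\<bar>E j\<bar> * \<bar>int j - int k\<bar> = int D" using Emult[of j] by (simp flip: abs_mult)
    moreover have "\<bar>E j\<bar> * 1 \<le> \<bar>E j\<bar> * \<bar>int j - int k\<bar>" using True by (intro mult_left_mono) auto
    ultimately show ?thesis by simp
  qed (simp add: E_def)
  have "\<forall>j. \<exists>q. (\<forall>i. q i = E j * (a j i - q (Suc i))) \<and> (\<forall>i\<ge>B j. q i = 0) \<and>
      \<bar>q 0\<bar> + (\<Sum>i<B j. \<bar>q i\<bar> * (2 * int D) ^ i) \<le> 2 * int D * (\<Sum>i<B j. \<bar>a j i\<bar> * (2 * int D) ^ i)"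
    by (intro allI twisted_antiderivative_coeffs supp Eabs)
  then obtain q where "\<forall>j. (\<forall>i. q j i = E j * (a j i - q j (Suc i))) \<and> (\<forall>i\<ge>B j. q j i = 0) \<and>
      \<bar>q j 0\<bar> + (\<Sum>i<B j. \<bar>q j i\<bar> * (2 * int D) ^ i) \<le> 2 * int D * (\<Sum>i<B j. \<bar>a j i\<bar> * (2 * int D) ^ i)"
    by (rule choice[THEN exE])
  hence q: "\<And>j i. q j i = E j * (a j i - q j (Suc i))" "\<And>j i. i \<ge> B j \<Longrightarrow> q j i = 0"
    and qle: "\<And>j. \<bar>q j 0\<bar> + (\<Sum>i<B j. \<bar>q j i\<bar> * (2 * int D) ^ i) \<le> 2 * int D * (\<Sum>i<B j. \<bar>a j i\<bar> * (2 * int D) ^ i)"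
    by blast+
  let ?J = "{..m} - {k}"
  \<comment> \<open>For \<open>j = k\<close> the twist cancels the exponential and an ordinary
    antiderivative, a shift of \<open>a k\<close>, remains. Its constant term is chosen so that the
    whole function vanishes at 0.\<close>
  define a' where "a' j i = (if j = k then (case i of 0 \<Rightarrow> - (\<Sum>j\<in>?J. q j 0) | Suc i \<Rightarrow> a k i) else q j i)" for j i
  have supp': "a' j i = 0" if "(B(k := Suc (B k))) j \<le> i" for j i
    using that q(2) supp unfolding a'_def by (auto split: if_splits nat.splits)
  have a'n: "a' j n = 0" for j using Bn by (intro supp') auto
  have rec: "int D * a' j (Suc i) + (int j - int k) * a' j i = int D * a j i" if "j \<le> m" for j i
  proof (cases "j = k")
    case False
    have "(int j - int k) * q j i = (E j * (int j - int k)) * (a j i - q j (Suc i))"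
      by (subst q(1)) simp
    thus ?thesis using False Emult[OF that False] by (simp add: a'_def right_diff_distrib)
  qed (simp add: a'_def)
  have split_k: "sum f {..m} = f k + sum f ?J" for f :: "nat \<Rightarrow> int"
    using k by (intro sum.remove) auto
  have n0: "n > 0" using Bn by simp
  have ext: "(\<Sum>i<n. \<bar>c j i\<bar> * (2 * int D) ^ i) = (\<Sum>i<B j. \<bar>c j i\<bar> * (2 * int D) ^ i)"
    if "\<And>i. i \<ge> B j \<Longrightarrow> c j i = 0" for c :: "nat \<Rightarrow> nat \<Rightarrow> int" and j
    using that Bn(1)[of j] by (intro sum.mono_neutral_right) auto
  have W: "coeff_weight m n D a' \<le> 2 * int D * coeff_weight m n D a"
  proof -
    have J: "(\<Sum>i<n. \<bar>a' j i\<bar> * (2 * int D) ^ i) = (\<Sum>i<B j. \<bar>q j i\<bar> * (2 * int D) ^ i)" if "j \<in> ?J" for j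
      using that ext[of j q] q(2) by (simp add: a'_def)
    obtain l where l: "n = Suc l" using n0 by (cases n) auto
    have "a k l = 0" using Bn(2) l by (intro supp) auto
    hence K: "(\<Sum>i<n. \<bar>a' k i\<bar> * (2 * int D) ^ i) = \<bar>a' k 0\<bar> + 2 * int D * (\<Sum>i<n. \<bar>a k i\<bar> * (2 * int D) ^ i)"
      unfolding l by (subst sum.lessThan_Suc_shift) (simp add: a'_def sum_distrib_left mult_ac)
    have K0: "\<bar>a' k 0\<bar> \<le> (\<Sum>j\<in>?J. \<bar>q j 0\<bar>)" by (simp add: a'_def sum_abs)
    have "coeff_weight m n D a' = (\<Sum>i<n. \<bar>a' k i\<bar> * (2 * int D) ^ i) + (\<Sum>j\<in>?J. \<Sum>i<n. \<bar>a' j i\<bar> * (2 * int D) ^ i)"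
      unfolding coeff_weight_def by (rule split_k)
    also have "\<dots> \<le> 2 * int D * (\<Sum>i<n. \<bar>a k i\<bar> * (2 * int D) ^ i) + (\<Sum>j\<in>?J. \<bar>q j 0\<bar> + (\<Sum>i<B j. \<bar>q j i\<bar> * (2 * int D) ^ i))"
      using J K K0 by (simp add: sum.distrib)
    also have "\<dots> \<le> 2 * int D * (\<Sum>i<n. \<bar>a k i\<bar> * (2 * int D) ^ i) + (\<Sum>j\<in>?J. 2 * int D * (\<Sum>i<n. \<bar>a j i\<bar> * (2 * int D) ^ i))"
    proof (intro add_left_mono sum_mono)
      fix j assume "j \<in> ?J"
      have e: "(\<Sum>i<n. \<bar>a j i\<bar> * (2 * int D) ^ i) = (\<Sum>i<B j. \<bar>a j i\<bar> * (2 * int D) ^ i)"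
        by (rule ext) (rule supp)
      show "\<bar>q j 0\<bar> + (\<Sum>i<B j. \<bar>q j i\<bar> * (2 * int D) ^ i) \<le> 2 * int D * (\<Sum>i<n. \<bar>a j i\<bar> * (2 * int D) ^ i)"
        unfolding e by (rule qle)
    qed
    also have "\<dots> = 2 * int D * coeff_weight m n D a"
      unfolding coeff_weight_def split_k by (simp add: sum_distrib_left distrib_left)
    finally show ?thesis .
  qed
  have Z: "exp_poly m n D a' 0 = 0"
  proof -
    have "(\<Sum>i<n. of_int (a' j i) * (real D * 0) ^ i / fact i) = of_int (a' j 0)" for j
    proof -
      have "(\<Sum>i<n. of_int (a' j i) * (real D * 0) ^ i / fact i) = (\<Sum>i<n. if i = 0 then real_of_int (a' j 0) else 0)"
        by (intro sum.cong) auto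
      thus ?thesis using n0 by simp
    qed
    hence "exp_poly m n D a' 0 = of_int (\<Sum>j\<le>m. a' j 0)" by (simp add: exp_poly_def)
    also have "(\<Sum>j\<le>m. a' j 0) = 0" unfolding split_k by (simp add: a'_def)
    finally show ?thesis by simp
  qed
  have deriv: "(exp_poly m n D a' has_real_derivative real k * exp_poly m n D a' z + real D * exp_poly m n D a z) (at z)" for z
  proof -
    define P where "P c j z = (\<Sum>i<n. of_int (c j i) * (real D * z) ^ i / fact i)" for c :: "nat \<Rightarrow> nat \<Rightarrow> int" and j z
    define P' where "P' j = (\<Sum>i<n. real D * of_int (a' j (Suc i)) * (real D * z) ^ i / fact i)" for j
    have P': "(P a' j has_real_derivative P' j) (at z)" for j
      unfolding P_def P'_def by (rule has_real_derivative_divided_power_sum) (rule a'n)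
    have rel: "P' j + (real j - real k) * P a' j z = real D * P a j z" if "j \<le> m" for j
    proof -
      have "P' j + (real j - real k) * P a' j z =
          (\<Sum>i<n. of_int (int D * a' j (Suc i) + (int j - int k) * a' j i) * (real D * z) ^ i / fact i)"
        unfolding P_def P'_def sum_distrib_left sum.distrib[symmetric]
        by (intro sum.cong) (simp_all add: algebra_simps add_divide_distrib diff_divide_distrib)
      also have "\<dots> = real D * P a j z"
        unfolding rec[OF that] P_def by (simp add: sum_distrib_left mult.assoc)
      finally show ?thesis .
    qed
    have "((\<lambda>z. \<Sum>j\<le>m. P a' j z * exp (real j * z)) has_real_derivative
       (\<Sum>j\<le>m. P' j * exp (real j * z) + (exp (real j * z) * real j) * P a' j z)) (at z)"
      by (intro DERIV_sum DERIV_mult P') (auto intro!: derivative_eq_intros)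
    also have "(\<Sum>j\<le>m. P' j * exp (real j * z) + (exp (real j * z) * real j) * P a' j z)
      = (\<Sum>j\<le>m. real k * (P a' j z * exp (real j * z)) + real D * (P a j z * exp (real j * z)))"
    proof (rule sum.cong)
      fix j assume "j \<in> {..m}"
      hence "P' j = real k * P a' j z - real j * P a' j z + real D * P a j z" using rel[of j] by (simp add: algebra_simps)
      thus "P' j * exp (real j * z) + (exp (real j * z) * real j) * P a' j z
          = real k * (P a' j z * exp (real j * z)) + real D * (P a j z * exp (real j * z))"
        by (simp only:) (simp add: algebra_simps)
    qed simp
    also have "\<dots> = real k * exp_poly m n D a' z + real D * exp_poly m n D a z"
      unfolding exp_poly_def P_def[symmetric] by (simp add: sum.distrib sum_distrib_left)
    finally show ?thesis unfolding P_def exp_poly_def[abs_def] by simp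
  qed
  show thesis by (rule that[OF supp' W Z deriv])
qed

text \<open>The integration step is iterated from the constant function 1, once for each entry of
  \<open>ks\<close>, and each step contributes one more power of \<open>z\<close> to the upper
  bound. The 0 in \<open>0 # ks\<close> accounts for the initial constant, so that
  \<open>count_list (0 # ks) j\<close> bounds the number of coefficients attached to
  \<open>exp (j * z)\<close>.\<close>

lemma exp_poly_high_order_zero:
  assumes "set ks \<subseteq> {..m}" and "\<And>j. count_list (0 # ks) j \<le> n" and D: "D = fact m"
  shows "\<exists>a. (\<forall>j i. count_list (0 # ks) j \<le> i \<longrightarrow> a j i = 0) \<and>
           coeff_weight m n D a \<le> (2 * int D) ^ length ks \<and>
           (\<forall>z>0. 0 < exp_poly m n D a z \<and>
              exp_poly m n D a z \<le> real D ^ length ks * exp (real m * z) * z ^ length ks / fact (length ks))"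
  using assms(1,2)
proof (induction ks)
  case Nil
  define a :: "nat \<Rightarrow> nat \<Rightarrow> int" where "a j i = (if j = 0 \<and> i = 0 then 1 else 0)" for j i
  have n: "n > 0" using Nil(2)[of 0] by simp
  have w: "(\<Sum>i<n. \<bar>a j i\<bar> * (2 * int D) ^ i) = (if j = 0 then 1 else 0)" for j
  proof -
    have "(\<Sum>i<n. \<bar>a j i\<bar> * (2 * int D) ^ i) = (\<Sum>i<n. if i = 0 then if j = 0 then 1 else 0 else 0)"
      by (intro sum.cong) (auto simp: a_def)
    thus ?thesis using n by simp
  qed
  have g: "(\<Sum>i<n. real_of_int (a j i) * (real D * z) ^ i / fact i) = (if j = 0 then 1 else 0)" for j z
  proof -
    have "(\<Sum>i<n. real_of_int (a j i) * (real D * z) ^ i / fact i) = (\<Sum>i<n. if i = 0 then if j = 0 then 1 else 0 else 0)"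
      by (intro sum.cong) (auto simp: a_def)
    thus ?thesis using n by simp
  qed
  have 1: "exp_poly m n D a z = 1" for z
  proof -
    have "exp_poly m n D a z = (\<Sum>j\<le>m. if j = 0 then 1 else 0)"
      unfolding exp_poly_def g by (intro sum.cong) auto
    thus ?thesis by simp
  qed
  have 2: "coeff_weight m n D a = 1" unfolding coeff_weight_def w by simp
  have "\<forall>j i. count_list [0] j \<le> i \<longrightarrow> a j i = 0" by (auto simp: a_def)
  then show ?case by (intro exI[of _ a]) (simp add: 1 2)
next
  case (Cons k ks)
  let ?t = "length ks"
  have k: "k \<le> m" and ks: "set ks \<subseteq> {..m}" using Cons.prems(1) by auto
  have le: "count_list (0 # ks) j \<le> n" for j using Cons.prems(2)[of j] by (auto split: if_splits)
  obtain a where supp: "\<And>j i. count_list (0 # ks) j \<le> i \<Longrightarrow> a j i = 0"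
    and wt: "coeff_weight m n D a \<le> (2 * int D) ^ ?t"
    and pos: "\<And>z. z > 0 \<Longrightarrow> 0 < exp_poly m n D a z"
    and bound: "\<And>z. z > 0 \<Longrightarrow> exp_poly m n D a z \<le> real D ^ ?t * exp (real m * z) * z ^ ?t / fact ?t"
    using Cons.IH[OF ks le] by blast
  have Suc_le: "Suc (count_list (0 # ks) k) \<le> n" using Cons.prems(2)[of k] by (auto split: if_splits)
  obtain a' where supp': "\<And>j i. ((count_list (0 # ks))(k := Suc (count_list (0 # ks) k))) j \<le> i \<Longrightarrow> a' j i = 0"
    and wt': "coeff_weight m n D a' \<le> 2 * int D * coeff_weight m n D a"
    and zero: "exp_poly m n D a' 0 = 0"
    and deriv: "\<And>z. (exp_poly m n D a' has_real_derivative real k * exp_poly m n D a' z + real D * exp_poly m n D a z) (at z)"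
    by (rule exp_poly_twisted_antiderivative[where B = "count_list (0 # ks)" and a = a, OF supp le Suc_le k D])
      (assumption | rule that; blast)+
  have D1: "D \<ge> 1" unfolding D by simp
  \<comment> \<open>The integrating factor removes the term with \<open>k\<close> from the
    differential equation, so \<open>h\<close> has a derivative that is positive for positive
    arguments.\<close>
  define h where "h z = exp (- real k * z) * exp_poly m n D a' z" for z
  have h': "(h has_real_derivative exp (- real k * z) * (real D * exp_poly m n D a z)) (at z)" for z
    unfolding h_def[abs_def]
    by (rule derivative_eq_intros deriv refl | simp)+ (simp add: algebra_simps)
  \<comment> \<open>This is the claimed upper bound times \<open>exp (- k * z)\<close>. Both
    \<open>u\<close> and \<open>h\<close> vanish at 0, and \<open>k \<le> m\<close> makes the
    derivative of \<open>u\<close> at least that of \<open>h\<close> on positive arguments.\<close>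
  define u where "u z = real D ^ Suc ?t * exp ((real m - real k) * z) * z ^ Suc ?t / fact (Suc ?t)" for z
  have u': "(u has_real_derivative
      (real m - real k) * u z + exp (- real k * z) * (real D * (real D ^ ?t * exp (real m * z) * z ^ ?t / fact ?t))) (at z)" for z
  proof -
    have "((\<lambda>z. (real D ^ Suc ?t * exp ((real m - real k) * z)) * (z ^ Suc ?t / fact (Suc ?t))) has_real_derivative
       (real D ^ Suc ?t * (exp ((real m - real k) * z) * (real m - real k))) * (z ^ Suc ?t / fact (Suc ?t))
       + z ^ ?t / fact ?t * (real D ^ Suc ?t * exp ((real m - real k) * z))) (at z)"
    proof (rule DERIV_mult)
      show "((\<lambda>z. real D ^ Suc ?t * exp ((real m - real k) * z)) has_real_derivative
         real D ^ Suc ?t * (exp ((real m - real k) * z) * (real m - real k))) (at z)"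
        by (rule derivative_eq_intros refl | simp)+
      show "((\<lambda>z. z ^ Suc ?t / fact (Suc ?t)) has_real_derivative z ^ ?t / fact ?t) (at z)"
        by (rule derivative_eq_intros refl | simp)+
    qed
    moreover have "exp ((real m - real k) * z) = exp (- real k * z) * exp (real m * z)"
      by (simp add: left_diff_distrib flip: exp_add)
    ultimately show ?thesis unfolding u_def[abs_def] by (simp add: algebra_simps diff_divide_distrib)
  qed
  have main: "0 < exp_poly m n D a' z \<and> exp_poly m n D a' z \<le> real D ^ Suc ?t * exp (real m * z) * z ^ Suc ?t / fact (Suc ?t)"
    if z: "z > 0" for z
  proof -
    have "h 0 < h z"
    proof (rule DERIV_pos_imp_increasing_open[OF z])
      fix x assume "0 < x" "x < z"
      hence "exp (- real k * x) * (real D * exp_poly m n D a x) > 0" using pos[of x] D1 by simp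
      thus "\<exists>y. (h has_real_derivative y) (at x) \<and> y > 0" using h'[of x] by blast
    next
      show "continuous_on {0..z} h" using h' by (intro DERIV_continuous_on) (rule has_field_derivative_at_within)
    qed
    hence "exp_poly m n D a' z > 0" by (simp add: h_def zero zero_less_mult_iff)
    moreover have "u 0 - h 0 \<le> u z - h z"
    proof (rule DERIV_nonneg_imp_increasing_open[of 0 z "\<lambda>z. u z - h z"])
      fix x assume x: "0 < x" "x < z"
      let ?v = "real D ^ ?t * exp (real m * x) * x ^ ?t / fact ?t"
      have d: "((\<lambda>z. u z - h z) has_real_derivative ((real m - real k) * u x + exp (- real k * x) * (real D * ?v))
          - exp (- real k * x) * (real D * exp_poly m n D a x)) (at x)"
        by (intro DERIV_diff u' h')
      have "exp (- real k * x) * (real D * exp_poly m n D a x) \<le> exp (- real k * x) * (real D * ?v)"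
        by (intro mult_left_mono bound x(1)) simp_all
      moreover have "(real m - real k) * u x \<ge> 0"
        unfolding u_def using k x by (intro mult_nonneg_nonneg divide_nonneg_nonneg zero_le_power) auto
      ultimately have nonneg: "0 \<le> ((real m - real k) * u x + exp (- real k * x) * (real D * ?v))
          - exp (- real k * x) * (real D * exp_poly m n D a x)" by linarith
      show "\<exists>y. ((\<lambda>z. u z - h z) has_real_derivative y) (at x) \<and> 0 \<le> y"
        by (rule exI, rule conjI, rule d, rule nonneg)
    next
      show "continuous_on {0..z} (\<lambda>z. u z - h z)"
        by (intro continuous_at_imp_continuous_on ballI DERIV_isCont[OF DERIV_diff[OF u' h']])
    qed (use z in simp)
    hence "h z \<le> u z" by (simp add: u_def h_def zero)
    hence "exp (real k * z) * h z \<le> exp (real k * z) * u z" by simp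
    moreover have "exp (real k * z) * h z = exp_poly m n D a' z"
      unfolding h_def by (simp flip: mult.assoc exp_add)
    moreover have "exp (real k * z) * u z = real D ^ Suc ?t * exp (real m * z) * z ^ Suc ?t / fact (Suc ?t)"
    proof -
      have "exp (real m * z) = exp (real k * z) * exp ((real m - real k) * z)"
        by (simp add: left_diff_distrib flip: exp_add)
      thus ?thesis unfolding u_def by (simp only: mult_ac times_divide_eq_right)
    qed
    ultimately show ?thesis by linarith
  qed
  have "coeff_weight m n D a' \<le> (2 * int D) ^ length (k # ks)"
  proof -
    have "2 * int D * coeff_weight m n D a \<le> 2 * int D * (2 * int D) ^ ?t"
      by (rule mult_left_mono[OF wt]) simp
    thus ?thesis using wt' by simp
  qed
  moreover have "\<forall>j i. count_list (0 # k # ks) j \<le> i \<longrightarrow> a' j i = 0"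
    using supp' by (auto split: if_splits)
  moreover have "\<forall>z>0. 0 < exp_poly m n D a' z \<and> exp_poly m n D a' z
      \<le> real D ^ length (k # ks) * exp (real m * z) * z ^ length (k # ks) / fact (length (k # ks))"
    using main by (simp only: list.size add_Suc_right add_0_right) auto
  ultimately show ?case by blast
qed

section \<open>The Hermite-Lindemann theorem for real numbers\<close>

text \<open>The induction step uses that \<open>fact n * fact (n * k)\<close> divides
  \<open>fact (n + n * k)\<close>. With \<open>k = Suc N\<close> this gives the one surplus
  factorial that decides the final estimate.\<close>

lemma fact_power_le_fact_mult: "(fact n :: real) ^ k \<le> fact (n * k)"
proof (induction k)
  case (Suc k)
  have "fact n * fact (n * k) dvd (fact (n + n * k) :: nat)" by (rule fact_fact_dvd_fact)
  hence "fact n * fact (n * k) \<le> (fact (n + n * k) :: nat)" by (rule dvd_imp_le) simp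
  hence "real (fact n * fact (n * k)) \<le> real (fact (n + n * k))" by (rule of_nat_mono)
  hence "(fact n :: real) * fact (n * k) \<le> fact (n + n * k)" by simp
  moreover have "(fact n :: real) * fact n ^ k \<le> fact n * fact (n * k)" by (intro mult_left_mono Suc) simp
  ultimately have "(fact n :: real) * fact n ^ k \<le> fact (n + n * k)" by linarith
  then show ?case by simp
qed simp

lemma count_list_concat_replicate: "count_list (concat (replicate n xs)) x = n * count_list xs x"
  by (induction n) auto

lemma count_list_distinct_le: "distinct xs \<Longrightarrow> count_list xs x \<le> 1"
  by (induction xs) auto

lemma length_concat_replicate: "length (concat (replicate n xs)) = n * length xs"
  by (induction n) auto

text \<open>Running \<open>n\<close> times through the exponents \<open>0, ..., m\<close> gives
  \<open>n * Suc m\<close> integration steps. With the initial constant each exponential carries at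
  most \<open>n + 1\<close> coefficients, so all degrees are at most \<open>n\<close> and the factor
  \<open>fact n\<close> clears the denominators of the divided powers.\<close>

lemma exp_poly_small_integer_combination:
  fixes z :: real
  assumes "n \<ge> 1"
  obtains q :: "nat \<times> nat \<Rightarrow> int" and g :: real where
    "(\<Sum>x\<in>{..n} \<times> {..m}. \<bar>real_of_int (q x)\<bar>) \<le> fact n * (2 * fact m) ^ (n * Suc m)"
    "g = (\<Sum>x\<in>{..n} \<times> {..m}. of_int (q x) * z ^ fst x * exp z ^ snd x)"
    "z > 0 \<Longrightarrow> 0 < g"
    "z > 0 \<Longrightarrow> g \<le> fact n * (fact m ^ (n * Suc m) * exp (real m * z) * z ^ (n * Suc m) / fact (n * Suc m))"
proof -
  define D :: nat where "D = fact m"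
  define ks where "ks = concat (replicate n [0..<Suc m])"
  have len: "length ks = n * Suc m" by (simp add: ks_def length_concat_replicate del: upt_Suc)
  have set: "set ks \<subseteq> {..m}" by (auto simp: ks_def)
  have count: "count_list (0 # ks) j \<le> Suc n" for j
  proof -
    have "count_list [0..<Suc m] j \<le> 1" by (rule count_list_distinct_le) simp
    hence "n * count_list [0..<Suc m] j \<le> n * 1" by (rule mult_left_mono) simp
    hence "count_list ks j \<le> n" by (simp add: ks_def count_list_concat_replicate del: upt_Suc)
    thus ?thesis by auto
  qed
  obtain a where wt: "coeff_weight m (Suc n) D a \<le> (2 * int D) ^ (n * Suc m)"
    and pos: "\<And>z. z > 0 \<Longrightarrow> 0 < exp_poly m (Suc n) D a z"
    and le: "\<And>z. z > 0 \<Longrightarrow> exp_poly m (Suc n) D a z \<le> real D ^ (n * Suc m) * exp (real m * z) * z ^ (n * Suc m) / fact (n * Suc m)"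
    using exp_poly_high_order_zero[OF set count D_def] unfolding len by blast
  \<comment> \<open>These are the coefficients of \<open>fact n\<close> times the exponential
    polynomial, with the scaling by \<open>D\<close> expanded; the division is exact for
    \<open>fst x \<le> n\<close>.\<close>
  define q where "q x = a (snd x) (fst x) * int D ^ fst x * (fact n div fact (fst x))" for x
  define g where "g = fact n * exp_poly m (Suc n) D a z"
  have fq: "real_of_int (fact n div fact i) = fact n / fact i" if "i \<le> n" for i
  proof -
    have "(fact i :: int) dvd fact n" using that by (rule fact_dvd)
    thus ?thesis by (simp add: real_of_int_div)
  qed
  show thesis
  proof (rule that)
    have "(\<Sum>x\<in>{..n} \<times> {..m}. \<bar>q x\<bar>) \<le> (\<Sum>x\<in>{..n} \<times> {..m}. fact n * (\<bar>a (snd x) (fst x)\<bar> * (2 * int D) ^ fst x))"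
    proof (rule sum_mono)
      fix x :: "nat \<times> nat"
      have "(fact n :: int) div fact (fst x) \<le> fact n"
        by (metis div_le_dividend of_nat_fact zdiv_int of_nat_le_iff)
      moreover have "int D ^ fst x \<le> (2 * int D) ^ fst x" by (intro power_mono) auto
      moreover have "(fact n :: int) div fact (fst x) \<ge> 0" by (simp add: pos_imp_zdiv_nonneg_iff)
      ultimately have le: "\<bar>a (snd x) (fst x)\<bar> * int D ^ fst x * (fact n div fact (fst x)) \<le> \<bar>a (snd x) (fst x)\<bar> * (2 * int D) ^ fst x * fact n"
        by (intro mult_mono mult_nonneg_nonneg) auto
      show "\<bar>q x\<bar> \<le> fact n * (\<bar>a (snd x) (fst x)\<bar> * (2 * int D) ^ fst x)"
        using le \<open>(fact n :: int) div fact (fst x) \<ge> 0\<close> by (simp add: q_def abs_mult mult_ac)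
    qed
    also have "\<dots> = fact n * coeff_weight m (Suc n) D a"
      unfolding coeff_weight_def
      by (subst sum.swap) (simp add: sum.cartesian_product sum_distrib_left case_prod_unfold lessThan_Suc_atMost)
    also have "\<dots> \<le> fact n * (2 * int D) ^ (n * Suc m)" by (intro mult_left_mono wt) simp
    finally have "real_of_int (\<Sum>x\<in>{..n} \<times> {..m}. \<bar>q x\<bar>) \<le> real_of_int (fact n * (2 * int D) ^ (n * Suc m))"
      by (simp only: of_int_le_iff)
    thus "(\<Sum>x\<in>{..n} \<times> {..m}. \<bar>real_of_int (q x)\<bar>) \<le> fact n * (2 * fact m) ^ (n * Suc m)"
      by (simp add: D_def)
    have "g = (\<Sum>j\<le>m. \<Sum>i\<le>n. of_int (q (i, j)) * z ^ i * exp z ^ j)"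
      unfolding g_def exp_poly_def sum_distrib_left sum_distrib_right lessThan_Suc_atMost
      by (intro sum.cong refl) (simp add: q_def fq exp_of_nat_mult power_mult_distrib)
    thus "g = (\<Sum>x\<in>{..n} \<times> {..m}. of_int (q x) * z ^ fst x * exp z ^ snd x)"
      by (subst (asm) sum.swap) (simp add: sum.cartesian_product case_prod_unfold)
    show "0 < g" if "z > 0" using pos[OF that] by (simp add: g_def)
    show "g \<le> fact n * (fact m ^ (n * Suc m) * exp (real m * z) * z ^ (n * Suc m) / fact (n * Suc m))" if "z > 0"
      unfolding g_def using le[OF that] by (intro mult_left_mono) (simp_all add: D_def)
  qed
qed

text \<open>For \<open>m = N\<close> the upper bound for \<open>g\<close> contributes one factor
  \<open>fact n\<close> and the Liouville bound contributes \<open>N - 1\<close> more. Against the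
  denominator \<open>fact (n * Suc N)\<close>, which is at least \<open>fact n ^ Suc N\<close>, a
  factor \<open>1 / fact n\<close> is left, and it outweighs every geometric growth in
  \<open>n\<close>.\<close>

lemma not_algebraic_exp_pos:
  fixes z :: real
  assumes z: "z > 0" and alg: "algebraic z" "algebraic (exp z)"
  shows False
proof -
  have alg': "algebraic (complex_of_real z)" "algebraic (complex_of_real (exp z))"
    unfolding algebraic_of_real_iff by (fact alg)+
  obtain N C where N: "N \<ge> 1" and C: "C \<ge> (1::real)" and
    lower: "\<And>T K q S k. finite K \<Longrightarrow> (\<And>x. x \<in> K \<Longrightarrow> fst x \<le> T \<and> snd x \<le> T) \<Longrightarrow>
       (\<Sum>x\<in>K. \<bar>real_of_int (q x)\<bar>) \<le> S \<Longrightarrow> 1 \<le> S \<Longrightarrow>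
       k = (\<Sum>x\<in>K. of_int (q x) * complex_of_real z ^ fst x * complex_of_real (exp z) ^ snd x) \<Longrightarrow>
       algebraic k \<and> (k \<noteq> 0 \<longrightarrow> 1 \<le> norm k * C ^ (T + 1) * S ^ (N - 1))"
    by (rule bivariate_int_polynomial_lower_bound[OF alg']) blast
  define F :: real where "F = fact N"
  \<comment> \<open>\<open>X\<close> collects what is raised to the power \<open>n\<close>, and
    \<open>A\<close> the factors independent of \<open>n\<close>; the factorials are treated
    separately.\<close>
  define X where "X = C * (F * z) ^ Suc N * ((2 * F) ^ Suc N) ^ (N - 1)"
  define A where "A = exp (real N * z) * C ^ (N + 1)"
  have F: "F \<ge> 1" by (simp add: F_def)
  have X0: "X \<ge> 0" using C F z by (simp add: X_def)
  have A0: "A > 0" using C by (simp add: A_def)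
  have le: "1 \<le> A * (X ^ n / fact n)" if n: "n \<ge> 1" for n
  proof -
    let ?t = "n * Suc N"
    let ?S = "fact n * (2 * F) ^ ?t"
    obtain q :: "nat \<times> nat \<Rightarrow> int" and g where
      q: "(\<Sum>x\<in>{..n} \<times> {..N}. \<bar>real_of_int (q x)\<bar>) \<le> ?S"
      and g: "g = (\<Sum>x\<in>{..n} \<times> {..N}. of_int (q x) * z ^ fst x * exp z ^ snd x)"
      and g0: "0 < g" and gle: "g \<le> fact n * (F ^ ?t * exp (real N * z) * z ^ ?t / fact ?t)"
      unfolding F_def by (rule exp_poly_small_integer_combination[OF n, of N z]) (use z in blast)
    have S1: "1 \<le> ?S"
      using mult_mono[of 1 "fact n" 1 "(2 * F) ^ ?t"] F one_le_power[of "2 * F" ?t] by simp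
    have "complex_of_real g = (\<Sum>x\<in>{..n} \<times> {..N}. of_int (q x) * complex_of_real z ^ fst x * complex_of_real (exp z) ^ snd x)"
      unfolding g by (simp only: of_real_sum of_real_mult of_real_power of_real_of_int_eq)
    \<comment> \<open>The exponents of \<open>z\<close> are at most \<open>n\<close> and those of
      \<open>exp z\<close> at most \<open>N\<close>, so \<open>T = n + N\<close> bounds
      both.\<close>
    hence "1 \<le> norm (complex_of_real g) * C ^ (n + N + 1) * ?S ^ (N - 1)"
      using lower[of "{..n} \<times> {..N}" "n + N" q ?S "complex_of_real g"] q S1 g0 by auto
    hence "1 \<le> g * (C ^ (n + N + 1) * ?S ^ (N - 1))" using g0 by (simp add: mult.assoc)
    also have "\<dots> \<le> fact n * (F ^ ?t * exp (real N * z) * z ^ ?t / fact ?t) * (C ^ (n + N + 1) * ?S ^ (N - 1))"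
      using C F by (intro mult_right_mono gle) auto
    also have "\<dots> = A * X ^ n * (fact n ^ N / fact ?t)"
    proof -
      obtain l where l: "N = Suc l" using N by (cases N) auto
      show ?thesis unfolding A_def X_def l
        by (simp only: diff_Suc_1 power_mult_distrib power_add power_mult[symmetric] power_Suc)
           (simp add: algebra_simps power_add)
    qed
    also have "\<dots> \<le> A * X ^ n * (1 / fact n)"
    proof (intro mult_left_mono)
      have "(fact n :: real) ^ N * fact n \<le> fact ?t"
        using fact_power_le_fact_mult[of n "Suc N"] by (simp add: mult.commute)
      thus "(fact n :: real) ^ N / fact ?t \<le> 1 / fact n" by (simp add: field_simps)
    qed (use A0 X0 in auto)
    finally show ?thesis by simp
  qed
  \<comment> \<open>The terms of the exponential series at \<open>X\<close> tend to 0.\<close>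
  have "(\<lambda>n. A * (inverse (fact n) * X ^ n)) \<longlonglongrightarrow> A * 0"
    by (intro tendsto_mult_left summable_LIMSEQ_zero summable_exp)
  hence "eventually (\<lambda>n. A * (inverse (fact n) * X ^ n) < 1) sequentially"
    by (rule order_tendstoD) simp
  then obtain n0 where n0: "\<And>n. n \<ge> n0 \<Longrightarrow> A * (inverse (fact n) * X ^ n) < 1"
    unfolding eventually_sequentially by blast
  define n where "n = max n0 1"
  have "A * (inverse (fact n) * X ^ n) < 1" by (rule n0) (simp add: n_def)
  moreover have "1 \<le> A * (X ^ n / fact n)" by (rule le) (simp add: n_def)
  ultimately show False by (simp add: divide_inverse mult.commute)
qed

lemma algebraic_exp_imp_zero:
  fixes z :: real
  assumes "algebraic z" "algebraic (exp z)"
  shows "z = 0"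
proof (rule ccontr)
  assume "z \<noteq> 0"
  then consider "z > 0" | "- z > 0" by linarith
  thus False
  proof cases
    case 2
    have "algebraic (exp (- z))" using assms(2) by (simp add: exp_minus algebraic_inverse)
    thus False using not_algebraic_exp_pos[of "- z"] 2 assms(1) by simp
  qed (rule not_algebraic_exp_pos[OF _ assms])
qed

section \<open>Sines at rational multiples of pi and the reflection formula\<close>

text \<open>For \<open>x = a / b\<close> the number \<open>w = cis (pi * x)\<close> is a root of
  unity of order dividing \<open>2 * b\<close>, and the sine is
  \<open>(w - cnj w) / (2 * \<i>)\<close>.\<close>

lemma algebraic_sin_pi_rat:
  assumes "x \<in> \<rat>"
  shows "algebraic (sin (pi * x))"
proof -
  obtain a b :: int where b: "b > 0" and x: "x = of_int a / of_int b"
    by (rule Rats_cases'[OF assms]) blast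
  define n where "n = nat (2 * b)"
  have n: "n > 0" "real n = 2 * of_int b" using b by (auto simp: n_def)
  define w where "w = cis (pi * x)"
  have "w ^ n = cis (real n * (pi * x))" unfolding w_def by (rule Complex.DeMoivre)
  also have "real n * (pi * x) = 2 * pi * of_int a" using b by (simp add: n x)
  finally have "w ^ n = 1" by (simp add: cis_multiple_2pi)
  have w: "algebraic w"
  proof (rule algebraicI)
    show "coeff (monom 1 n - 1 :: complex poly) i \<in> \<int>" for i by simp
    show "poly (monom 1 n - 1) w = 0" using \<open>w ^ n = 1\<close> by (simp add: poly_monom)
    have "coeff (monom 1 n - 1 :: complex poly) n = 1" using n by simp
    thus "monom 1 n - 1 \<noteq> (0 :: complex poly)" by (metis coeff_0 zero_neq_one)
  qed
  have "algebraic ((w + - cnj w) * inverse (2 * \<i>))"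
    by (intro algebraic_mult algebraic_add algebraic_inverse algebraic_minus algebraic_cnj w algebraic_ii rat_imp_algebraic) simp
  also have "w + - cnj w = complex_of_real (sin (pi * x)) * (2 * \<i>)"
    by (simp add: w_def complex_eq_iff)
  finally show ?thesis by (simp add: mult.assoc)
qed

lemma algebraic_diff_real:
  assumes "algebraic x" "algebraic (y :: real)"
  shows "algebraic (x - y)"
proof -
  have "algebraic (complex_of_real x + complex_of_real (- y))"
    using assms by (intro algebraic_add) (simp_all only: algebraic_of_real_iff algebraic_minus_iff)
  thus ?thesis by (simp only: of_real_add[symmetric] algebraic_of_real_iff) simp
qed

lemma algebraic_divide_real:
  assumes "algebraic x" "algebraic (y :: real)"
  shows "algebraic (x / y)"
proof -
  have "algebraic (complex_of_real x * complex_of_real (inverse y))"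
    using assms by (intro algebraic_mult) (auto simp only: algebraic_of_real_iff)
  thus ?thesis by (simp only: of_real_mult[symmetric] algebraic_of_real_iff divide_inverse)
qed

text \<open>Euler's reflection formula is transferred from the complex numbers; both Gamma values
  are positive, so the logarithm of their product splits.\<close>

lemma ln_Gamma_add_ln_Gamma_reflection:
  fixes x :: real
  assumes "0 < x" "x < 1"
  shows "ln (Gamma x) + ln (Gamma (1 - x)) = ln (pi / sin (pi * x))"
proof -
  have "complex_of_real (Gamma x * Gamma (1 - x)) = Gamma (complex_of_real x) * Gamma (1 - complex_of_real x)"
    by (simp flip: Gamma_complex_of_real)
  also have "\<dots> = complex_of_real (pi / sin (pi * x))"
    unfolding Gamma_reflection_complex by (simp add: sin_of_real flip: of_real_mult)
  finally have "Gamma x * Gamma (1 - x) = pi / sin (pi * x)" by (simp only: of_real_eq_iff)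
  moreover have "Gamma x > 0" "Gamma (1 - x) > 0" using assms by (auto intro: Gamma_real_pos)
  ultimately show ?thesis using ln_mult_pos[of "Gamma x" "Gamma (1 - x)"] by simp
qed

text \<open>Write the difference of the sines as a product: the sine factor vanishes only for
  \<open>x = y\<close>, the cosine factor only for \<open>x + y = pi\<close>.\<close>

lemma sin_eq_imp_eq_or_supplement:
  fixes x y :: real
  assumes x: "0 < x" "x < pi" and y: "0 < y" "y < pi" and eq: "sin x = sin y"
  shows "y = x \<or> y = pi - x"
proof -
  have "2 * sin ((x - y) / 2) * cos ((x + y) / 2) = sin x - sin y"
    by (rule sin_diff_sin[symmetric])
  also have "\<dots> = 0" by (simp only: eq diff_self)
  finally consider "sin ((x - y) / 2) = 0" | "cos ((x + y) / 2) = 0" by auto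
  thus ?thesis
  proof cases
    case 1
    have "- pi < (x - y) / 2" "(x - y) / 2 < pi" using x y by simp_all
    hence "(x - y) / 2 = 0" using 1 by (rule sin_eq_0_pi)
    thus ?thesis by simp
  next
    case 2
    have bounds: "0 \<le> (x + y) / 2" "(x + y) / 2 \<le> pi" using x y by simp_all
    have right: "0 \<le> pi / 2" "pi / 2 \<le> pi" by simp_all
    have "cos ((x + y) / 2) = cos (pi / 2)" using 2 by simp
    with bounds right have "(x + y) / 2 = pi / 2" by (rule cos_inj_pi)
    thus ?thesis by simp
  qed
qed

lemma sin_pi_eq_imp:
  fixes x y :: real
  assumes "0 < x" "x < 1" "0 < y" "y < 1" "sin (pi * x) = sin (pi * y)"
  shows "y = x \<or> y = 1 - x"
proof -
  have "pi * y = pi * x \<or> pi * y = pi - pi * x"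
    using assms by (intro sin_eq_imp_eq_or_supplement) simp_all
  moreover have "pi - pi * x = pi * (1 - x)" by (simp add: right_diff_distrib)
  ultimately show ?thesis by (simp only: mult_cancel_left pi_neq_zero simp_thms)
qed

theorem mainTheorem1:
  shows "finite {x::real. x \<in> \<rat> \<and> 0 < x \<and> x < 1 \<and>
                 algebraic (ln (Gamma x) + ln (Gamma (1 - x)))}
         \<and> card {x::real. x \<in> \<rat> \<and> 0 < x \<and> x < 1 \<and>
                 algebraic (ln (Gamma x) + ln (Gamma (1 - x)))} \<le> 2"
proof -
  let ?S = "{x::real. x \<in> \<rat> \<and> 0 < x \<and> x < 1 \<and> algebraic (ln (Gamma x) + ln (Gamma (1 - x)))}"
  have pair: "y = x \<or> y = 1 - x" if x: "x \<in> ?S" and y: "y \<in> ?S" for x y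
  proof -
    let ?a = "ln (pi / sin (pi * x)) - ln (pi / sin (pi * y))"
    have sx: "sin (pi * x) > 0" using x by (intro sin_gt_zero) auto
    have sy: "sin (pi * y) > 0" using y by (intro sin_gt_zero) auto
    have L: "algebraic (ln (pi / sin (pi * t)))" if "t \<in> ?S" for t
    proof -
      have "0 < t" "t < 1" "algebraic (ln (Gamma t) + ln (Gamma (1 - t)))" using that by blast+
      thus ?thesis by (simp only: ln_Gamma_add_ln_Gamma_reflection)
    qed
    have "algebraic ?a" by (intro algebraic_diff_real L x y)
    \<comment> \<open>The factor \<open>pi\<close> cancels in the exponential, which leaves a
      quotient of algebraic sines.\<close>
    moreover have e: "exp ?a = sin (pi * y) / sin (pi * x)"
      using sx sy by (simp add: exp_diff)
    have "algebraic (exp ?a)"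
      unfolding e using x y by (intro algebraic_divide_real algebraic_sin_pi_rat) auto
    ultimately have "?a = 0" by (rule algebraic_exp_imp_zero)
    hence "sin (pi * x) = sin (pi * y)" using e sx by simp
    thus ?thesis using x y by (intro sin_pi_eq_imp) auto
  qed
  \<comment> \<open>Any member of \<open>?S\<close> serves as \<open>x\<close>; if \<open>?S\<close>
    is empty, any real number does.\<close>
  have "\<exists>x. ?S \<subseteq> {x, 1 - x}" using pair by blast
  then obtain x where sub: "?S \<subseteq> {x, 1 - x}" ..
  have "card ?S \<le> card {x, 1 - x}" using sub by (intro card_mono) auto
  also have "\<dots> \<le> 2" by (simp add: card_insert_if)
  finally show ?thesis using finite_subset[OF sub] by simp
qed

end
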